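(* Let $f\in\mathcal C^1(\mathbb R^n)$ be globally bounded below by $f_*$, with $\|\nabla f(x)-\nabla f(y)\|\le L\|x-y\|$ for all $x,y\in\mathbb R^n$ and some $L>0$. Let the sequence of random models and corresponding directions generated in the line-search algorithm described in the context be $(p)$-probabilistically sufficiently accurate, with constant $\kappa>0$ and with $p>1/2$. Then the expected number of iterations $N_\epsilon$ that the algorithm takes until $\|\nabla f(X^k)\|\le\epsilon$ occurs is bounded as follows: $$\mathbb E(N_\epsilon)\le\frac{2p}{(2p-1)^2}\left[\frac{M}{\epsilon^2}+\log_\gamma\left(\frac{1-\theta}{\alpha_0(0.5L+\kappa)}\right)\right],$$ where $M=\frac{(f(x^0)-f_* )(1+\kappa\alpha_{\max})^2(0.5L+\kappa)}{\theta(1-\theta)}$ is a constant independent of $p$ and $\epsilon$.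
   Context: Line-search algorithm with random models. Constants $\gamma\in(0,1)$, $\theta\in(0,1)$, $\alpha_{\max}>0$; initial $x^0\in\mathbb R^n$ and $0<\alpha_0<\alpha_{\max}$. At iteration $k=0,1,\dots$: compute a random model $m_k$ (the linear model $m_k(x)=f(x^k)+(x-x^k)^Tg^k$) and use it to generate a direction $g^k$; check the sufficient decrease condition $f(x^k-\alpha_kg^k)\le f(x^k)-\alpha_k\theta\|g^k\|^2$. If it holds (successful iteration), set $x^{k+1}=x^k-\alpha_kg^k$ and $\alpha_{k+1}=\min\{\alpha_{\max},\gamma^{-1}\alpha_k\}$. Otherwise (unsuccessful), set $x^{k+1}=x^k$ and $\alpha_{k+1}=\gamma\alpha_k$. Capital letters $M_k,G^k,X^k,\mathcal A_k$ denote the random variables whose realizations are $m_k,g^k,x^k,\alpha_k$. The sequence is $(p)$-probabilistically sufficiently accurate if there is a constant $\kappa>0$ such that the indicators $I_k=\mathbb 1\{\|G^k-\nabla f(X^k)\|\le\kappa\mathcal A_k\|G^k\|\}$ satisfy $P(I_k=1\mid\mathcal F^M_{k-1})\ge p$, where $\mathcal F^M_{k-1}=\sigma(M_0,\dots,M_{k-1})$. In the underlying general analysis it is assumed, without loss of generality, that the threshold $C=\frac{1-\theta}{0.5L+\kappa}$ (below which every true iteration, i.e. one with $I_k=1$, is successful) has the form $C=\gamma^c\alpha_0<\gamma\alpha_{\max}$ for some positive integer $c$.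
   Formalization: It is additionally assumed that α_max = γ^{-j}α_0 for a natural number j, so that all step sizes lie on the grid {γ^iα_0} containing C; without this the stated bound can fail once a step size is capped at an α_max that lies off the grid. *)

theory Defs
  imports "HOL-Probability.Probability"
begin

definition linear_model ::
  "('a::real_inner \<Rightarrow> real) \<Rightarrow> 'a \<Rightarrow> 'a \<Rightarrow> 'a \<Rightarrow> real" where
  "linear_model f x g y = f x + (y - x) \<bullet> g"

definition sufficient_decrease ::
  "('a::real_inner \<Rightarrow> real) \<Rightarrow> real \<Rightarrow> 'a \<Rightarrow> real \<Rightarrow> 'a \<Rightarrow> bool" where
  "sufficient_decrease f \<theta> x \<alpha> g \<longleftrightarrow> f (x - \<alpha> *\<^sub>R g) \<le> f x - \<alpha> * \<theta> * (norm g)\<^sup>2"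

text \<open>One realization of the algorithm: iterates \<open>x\<close>, step sizes \<open>\<alpha>\<close> and directions \<open>g\<close>. The
  directions are the input of the run; the other two sequences are determined by them.\<close>

definition line_search_run ::
  "('a::real_inner \<Rightarrow> real) \<Rightarrow> real \<Rightarrow> real \<Rightarrow> real \<Rightarrow> 'a \<Rightarrow> real \<Rightarrow>
   (nat \<Rightarrow> 'a) \<Rightarrow> (nat \<Rightarrow> real) \<Rightarrow> (nat \<Rightarrow> 'a) \<Rightarrow> bool" where
  "line_search_run f \<gamma> \<theta> \<alpha>max x0 \<alpha>0 x \<alpha> g \<longleftrightarrow>
     x 0 = x0 \<and> \<alpha> 0 = \<alpha>0 \<and>
     (\<forall>k. if sufficient_decrease f \<theta> (x k) (\<alpha> k) (g k)
          then x (Suc k) = x k - \<alpha> k *\<^sub>R g k \<and> \<alpha> (Suc k) = min \<alpha>max (inverse \<gamma> * \<alpha> k)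
          else x (Suc k) = x k \<and> \<alpha> (Suc k) = \<gamma> * \<alpha> k)"

text \<open>The \<open>\<sigma>\<close>-algebra generated by the models with index \<open>j < k\<close>, that is
  \<open>\<sigma>(M\<^sub>0, \<dots>, M\<^sub>k\<^sub>-\<^sub>1)\<close>; it is trivial for \<open>k = 0\<close>. A model is a random function, and the
  function space carries the \<open>\<sigma>\<close>-algebra generated by the point evaluations.\<close>

definition past_models ::
  "'w measure \<Rightarrow> (nat \<Rightarrow> 'w \<Rightarrow> 'a \<Rightarrow> real) \<Rightarrow> nat \<Rightarrow> 'w measure" where
  "past_models P M k =
     sigma (space P) {(\<lambda>\<omega>. M j \<omega> y) -` B \<inter> space P | j y B. j < k \<and> B \<in> sets borel}"

text \<open>The argument \<open>gradf\<close> stands for the gradient field of the objective.\<close>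

definition prob_sufficiently_accurate ::
  "'w measure \<Rightarrow> ('a::real_inner \<Rightarrow> 'a) \<Rightarrow> real \<Rightarrow> real \<Rightarrow> (nat \<Rightarrow> 'w \<Rightarrow> 'a \<Rightarrow> real) \<Rightarrow>
   (nat \<Rightarrow> 'w \<Rightarrow> 'a) \<Rightarrow> (nat \<Rightarrow> 'w \<Rightarrow> real) \<Rightarrow> (nat \<Rightarrow> 'w \<Rightarrow> 'a) \<Rightarrow> bool" where
  "prob_sufficiently_accurate P gradf p \<kappa> M X A G \<longleftrightarrow>
     (\<forall>k. AE \<omega> in P.
        p \<le> real_cond_exp P (past_models P M k)
              (indicator {\<omega> \<in> space P. norm (G k \<omega> - gradf (X k \<omega>)) \<le> \<kappa> * A k \<omega> * norm (G k \<omega>)}) \<omega>)"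

text \<open>The index of the first \<open>\<epsilon>\<close>-stationary iterate, \<open>\<infinity>\<close> if there is none.\<close>

definition hitting_time :: "('a::real_normed_vector \<Rightarrow> 'a) \<Rightarrow> real \<Rightarrow> (nat \<Rightarrow> 'a) \<Rightarrow> enat" where
  "hitting_time gradf \<epsilon> x = (INF k \<in> {k. norm (gradf (x k)) \<le> \<epsilon>}. enat k)"

end

theory Submission
  imports Defs
begin

text \<open>Write \<open>C = (1 - \<theta>) / (L / 2 + \<kappa>)\<close>. All step sizes have the form \<open>\<gamma> ^ n * \<alpha>max\<close>, and \<open>C\<close> is such a
  number too, with exponent \<open>m = c + j\<close>. A successful accurate step with \<open>n \<le> m\<close> taken from a
  point that is not \<open>\<epsilon>\<close>-stationary decreases \<open>f\<close> by at least
  \<open>h = \<theta> * C * \<epsilon>\<^sup>2 / (1 + \<kappa> * \<alpha>max)\<^sup>2\<close>. Hence the potential \<open>2 * (f x - fstar) / h + \<bar>n - m\<bar>\<close> drops by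
  at least 1 in every accurate iteration (either it is successful, and if \<open>n > m\<close> then \<open>n\<close> moves
  towards \<open>m\<close>, or it fails, which forces \<open>n < m\<close>), while in any other iteration it grows by at most 1.
  Before the hitting time, accurate iterations therefore outnumber the others by at most the
  initial potential \<open>2 * (f x0 - fstar) / h + c\<close>. As the accurate ones have conditional probability at
  least \<open>p\<close>, the expected hitting time is at most this potential divided by \<open>2 * p - 1\<close>, which is
  better than the stated bound because \<open>p \<le> 1\<close>.\<close>

section \<open>Deterministic descent along a single run\<close>

text \<open>Subtracting the quadratic model of \<open>f\<close> along the ray
  \<open>x + t *\<^sub>R d\<close> leaves a function whose derivative is nonpositive for
  \<open>0 \<le> t\<close>, by Cauchy-Schwarz and the Lipschitz condition; compare
  \<open>t = 1\<close> with \<open>t = 0\<close>.\<close>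

lemma Lipschitz_gradient_upper_bound:
  fixes f :: "'a::real_inner \<Rightarrow> real"
  assumes gradient: "\<And>x. GDERIV f x :> gradf x"
    and Lipschitz: "\<And>x y. norm (gradf x - gradf y) \<le> L * norm (x - y)"
  shows "f (x + d) \<le> f x + d \<bullet> gradf x + L / 2 * (norm d)\<^sup>2"
proof -
  define \<phi> where "\<phi> t = f (x + t *\<^sub>R d) - t * (d \<bullet> gradf x) - L / 2 * t\<^sup>2 * (norm d)\<^sup>2" for t
  have deriv: "(\<phi> has_real_derivative
      d \<bullet> gradf (x + t *\<^sub>R d) - d \<bullet> gradf x - L * t * (norm d)\<^sup>2) (at t)" for t
  proof -
    have "(f has_derivative (\<lambda>h. h \<bullet> gradf (x + t *\<^sub>R d))) (at (x + t *\<^sub>R d))"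
      using gradient[of "x + t *\<^sub>R d"] by (simp add: gderiv_def)
    moreover have "((\<lambda>t. x + t *\<^sub>R d) has_derivative (\<lambda>h. h *\<^sub>R d)) (at t)"
      by (auto intro!: derivative_eq_intros)
    ultimately have "((\<lambda>t. f (x + t *\<^sub>R d)) has_derivative (\<lambda>h. (h *\<^sub>R d) \<bullet> gradf (x + t *\<^sub>R d))) (at t)"
      by (rule has_derivative_compose[rotated])
    then have "((\<lambda>t. f (x + t *\<^sub>R d)) has_real_derivative d \<bullet> gradf (x + t *\<^sub>R d)) (at t)"
      by (rule has_derivative_imp_has_field_derivative) simp
    then show ?thesis
      unfolding \<phi>_def by (auto intro!: derivative_eq_intros)
  qed
  have "d \<bullet> gradf (x + t *\<^sub>R d) - d \<bullet> gradf x - L * t * (norm d)\<^sup>2 \<le> 0" if "0 \<le> t" for t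
  proof -
    have "d \<bullet> gradf (x + t *\<^sub>R d) - d \<bullet> gradf x = d \<bullet> (gradf (x + t *\<^sub>R d) - gradf x)"
      by (simp add: inner_diff_right)
    also have "\<dots> \<le> norm d * norm (gradf (x + t *\<^sub>R d) - gradf x)"
      by (rule norm_cauchy_schwarz)
    also have "\<dots> \<le> norm d * (L * norm (t *\<^sub>R d))"
      using Lipschitz[of "x + t *\<^sub>R d" x] by (intro mult_left_mono) auto
    also have "\<dots> = L * t * (norm d)\<^sup>2"
      using that by (simp add: power2_eq_square)
    finally show ?thesis by simp
  qed
  then have "\<phi> 1 \<le> \<phi> 0"
    using deriv by (intro DERIV_nonpos_imp_nonincreasing[of 0 1 \<phi>]) (simp, blast)
  then show ?thesis by (simp add: \<phi>_def)
qed

text \<open>Accuracy and Cauchy-Schwarz make \<open>g \<bullet> gradf x\<close> at least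
  \<open>(1 - \<kappa> * \<alpha>) * (norm g)\<^sup>2\<close>. The quadratic upper bound then
  guarantees a decrease of \<open>\<alpha> * (1 - \<alpha> * (L / 2 + \<kappa>)) * (norm
  g)\<^sup>2\<close>, and \<open>small\<close> bounds the middle factor below by
  \<open>\<theta>\<close>.\<close>

lemma sufficient_decrease_of_accurate:
  fixes f :: "'a::real_inner \<Rightarrow> real"
  assumes gradient: "\<And>x. GDERIV f x :> gradf x"
    and Lipschitz: "\<And>x y. norm (gradf x - gradf y) \<le> L * norm (x - y)"
    and accurate: "norm (g - gradf x) \<le> \<kappa> * \<alpha> * norm g"
    and "0 \<le> \<alpha>" and small: "\<alpha> * (L / 2 + \<kappa>) \<le> 1 - \<theta>"
  shows "sufficient_decrease f \<theta> x \<alpha> g"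
proof -
  have "g \<bullet> (g - gradf x) \<le> norm g * norm (g - gradf x)"
    by (rule norm_cauchy_schwarz)
  also have "\<dots> \<le> norm g * (\<kappa> * \<alpha> * norm g)"
    using accurate by (intro mult_left_mono) auto
  finally have "(1 - \<kappa> * \<alpha>) * (norm g)\<^sup>2 \<le> g \<bullet> gradf x"
    by (simp add: inner_diff_right power2_norm_eq_inner[symmetric] power2_eq_square algebra_simps)
  then have "\<alpha> * ((1 - \<kappa> * \<alpha>) * (norm g)\<^sup>2) \<le> \<alpha> * (g \<bullet> gradf x)"
    using \<open>0 \<le> \<alpha>\<close> by (rule mult_left_mono)
  moreover have "f (x - \<alpha> *\<^sub>R g) \<le> f x - \<alpha> * (g \<bullet> gradf x) + L / 2 * \<alpha>\<^sup>2 * (norm g)\<^sup>2"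
    using Lipschitz_gradient_upper_bound[OF gradient Lipschitz, of x "- \<alpha> *\<^sub>R g"]
    by (simp add: power_mult_distrib)
  moreover have "\<alpha> * (norm g)\<^sup>2 * (\<alpha> * (L / 2 + \<kappa>)) \<le> \<alpha> * (norm g)\<^sup>2 * (1 - \<theta>)"
    using small \<open>0 \<le> \<alpha>\<close> by (intro mult_left_mono) auto
  ultimately show ?thesis
    unfolding sufficient_decrease_def by (simp add: algebra_simps power2_eq_square)
qed

text \<open>Sums the one-step changes of the potential by induction. The assumption
  \<open>far\<close> stops before \<open>K\<close>, so the bound also covers the first iterate after
  the last one known to be non-stationary.\<close>

lemma line_search_potential:
  fixes f :: "'a::real_inner \<Rightarrow> real" and I :: "nat \<Rightarrow> bool"
  assumes \<gamma>: "0 < \<gamma>" "\<gamma> < 1" and \<theta>: "0 < \<theta>" and \<alpha>max: "0 < \<alpha>max" and "0 < \<kappa>" and "0 < L"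
    and gradient: "\<And>x. GDERIV f x :> gradf x"
    and Lipschitz: "\<And>x y. norm (gradf x - gradf y) \<le> L * norm (x - y)"
    and run: "line_search_run f \<gamma> \<theta> \<alpha>max x0 (\<gamma> ^ j * \<alpha>max) x \<alpha> g"
    and threshold: "\<gamma> ^ m * \<alpha>max * (L / 2 + \<kappa>) = 1 - \<theta>"
    and I: "\<And>k. I k \<longleftrightarrow> norm (g k - gradf (x k)) \<le> \<kappa> * \<alpha> k * norm (g k)"
    and h: "h = \<theta> * (\<gamma> ^ m * \<alpha>max) * \<epsilon>\<^sup>2 / (1 + \<kappa> * \<alpha>max)\<^sup>2" and "0 < \<epsilon>"
    and far: "\<And>k. k < K \<Longrightarrow> \<epsilon> < norm (gradf (x k))"
  shows "\<exists>n. \<alpha> K = \<gamma> ^ n * \<alpha>max \<and>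
    (\<Sum>k<K. if I k then 1 else -1) + 2 * f (x K) / h + \<bar>real n - real m\<bar>
      \<le> 2 * f x0 / h + \<bar>real j - real m\<bar>"
  using far
proof (induction K)
  case 0
  then show ?case
    using run by (auto simp: line_search_run_def intro!: exI[of _ j])
next
  case (Suc K)
  then obtain n where n: "\<alpha> K = \<gamma> ^ n * \<alpha>max"
    and IH: "(\<Sum>k<K. if I k then 1 else -1) + 2 * f (x K) / h + \<bar>real n - real m\<bar>
      \<le> 2 * f x0 / h + \<bar>real j - real m\<bar>"
    by auto
  have "0 < \<alpha> K" using n \<gamma> \<alpha>max by simp
  have "\<alpha> K \<le> \<alpha>max" using n \<gamma> \<alpha>max by (simp add: power_le_one)
  have "0 < h"
    using \<gamma> \<theta> \<alpha>max \<open>0 < \<kappa>\<close> \<open>0 < \<epsilon>\<close> unfolding h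
    by (intro divide_pos_pos mult_pos_pos zero_less_power add_pos_pos) auto
  show ?case
  proof (cases "sufficient_decrease f \<theta> (x K) (\<alpha> K) (g K)")
    case True
    then have next_iterate: "x (Suc K) = x K - \<alpha> K *\<^sub>R g K" "\<alpha> (Suc K) = min \<alpha>max (inverse \<gamma> * \<alpha> K)"
      using run by (auto simp: line_search_run_def)
    \<comment> \<open>Truncated subtraction mirrors the cap: for \<open>n = 0\<close> the step size
      is already \<open>\<alpha>max\<close> and stays there.\<close>
    have step: "\<alpha> (Suc K) = \<gamma> ^ (n - 1) * \<alpha>max"
    proof (cases n)
      case 0
      then show ?thesis using next_iterate n \<gamma> \<alpha>max by (simp add: min_def field_simps)
    next
      case (Suc i)
      have "\<gamma> ^ i * \<alpha>max \<le> 1 * \<alpha>max"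
        using \<gamma> \<alpha>max by (intro mult_right_mono power_le_one) auto
      moreover have "inverse \<gamma> * \<alpha> K = \<gamma> ^ i * \<alpha>max"
        using Suc n \<gamma> by simp
      ultimately show ?thesis using Suc next_iterate by simp
    qed
    have decrease: "f (x (Suc K)) \<le> f (x K) - \<alpha> K * \<theta> * (norm (g K))\<^sup>2"
      using True next_iterate by (simp add: sufficient_decrease_def)
    moreover have "0 \<le> \<alpha> K * \<theta> * (norm (g K))\<^sup>2"
      using \<open>0 < \<alpha> K\<close> \<theta> by simp
    ultimately have nonincreasing: "2 * f (x (Suc K)) / h \<le> 2 * f (x K) / h"
      using \<open>0 < h\<close> by (simp add: divide_right_mono)
    \<comment> \<open>A drop of 2 pays both for the new summand 1 and for \<open>n - 1\<close>
      possibly moving away from \<open>m\<close> by 1.\<close>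
    have "2 * f (x (Suc K)) / h \<le> 2 * f (x K) / h - 2" if "I K" "n \<le> m"
    proof -
      have "norm (gradf (x K)) \<le> norm (g K) + norm (g K - gradf (x K))"
        by (metis norm_minus_commute norm_triangle_sub)
      also have "\<dots> \<le> norm (g K) + \<kappa> * \<alpha> K * norm (g K)"
        using that I by simp
      also have "\<dots> \<le> norm (g K) + \<kappa> * \<alpha>max * norm (g K)"
        using \<open>\<alpha> K \<le> \<alpha>max\<close> \<open>0 < \<kappa>\<close> by (intro add_left_mono mult_right_mono) auto
      finally have "\<epsilon> \<le> (1 + \<kappa> * \<alpha>max) * norm (g K)"
        using Suc.prems[of K] by (simp add: algebra_simps)
      then have "\<epsilon> / (1 + \<kappa> * \<alpha>max) \<le> norm (g K)"
        using \<open>0 < \<kappa>\<close> \<alpha>max by (simp add: divide_le_eq mult.commute add_pos_pos)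
      then have "(\<epsilon> / (1 + \<kappa> * \<alpha>max))\<^sup>2 \<le> (norm (g K))\<^sup>2"
        using \<open>0 < \<epsilon>\<close> \<open>0 < \<kappa>\<close> \<alpha>max by (intro power_mono) auto
      moreover have "\<theta> * (\<gamma> ^ m * \<alpha>max) \<le> \<alpha> K * \<theta>"
        unfolding n using \<gamma> \<theta> \<alpha>max \<open>n \<le> m\<close> by (simp add: power_decreasing)
      ultimately have "h \<le> \<alpha> K * \<theta> * (norm (g K))\<^sup>2"
        unfolding h times_divide_eq_right[symmetric] power_divide[symmetric]
        using \<open>0 < \<alpha> K\<close> \<theta> by (intro mult_mono[of "_ * _" "_ * _"]) auto
      with decrease have "2 * f (x (Suc K)) \<le> 2 * f (x K) - 2 * h" by simp
      then show ?thesis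
        using \<open>0 < h\<close> by (simp add: field_simps)
    qed
    with nonincreasing IH step show ?thesis
      by (intro exI[of _ "n - 1"]) (cases "I K"; cases "n \<le> m"; cases n; auto)
  next
    case False
    then have next_iterate: "x (Suc K) = x K" "\<alpha> (Suc K) = \<gamma> ^ Suc n * \<alpha>max"
      using run n by (auto simp: line_search_run_def)
    \<comment> \<open>Otherwise the step size would be below the threshold and the accurate step
      would succeed. With \<open>n < m\<close>, passing to \<open>Suc n\<close> lowers the distance
      to \<open>m\<close> by 1.\<close>
    have "n < m" if "I K"
    proof (rule ccontr)
      assume "\<not> n < m"
      then have "\<alpha> K \<le> \<gamma> ^ m * \<alpha>max"
        unfolding n using \<gamma> \<alpha>max by (simp add: power_decreasing)
      then have "\<alpha> K * (L / 2 + \<kappa>) \<le> 1 - \<theta>"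
        unfolding threshold[symmetric] using \<open>0 < \<kappa>\<close> \<open>0 < L\<close> by (intro mult_right_mono) auto
      with False show False
        using sufficient_decrease_of_accurate[OF gradient Lipschitz, of "g K" "x K" \<kappa> "\<alpha> K" \<theta>]
          \<open>0 < \<alpha> K\<close> \<open>I K\<close> I by simp
    qed
    with IH next_iterate show ?thesis
      by (intro exI[of _ "Suc n"]) (cases "I K"; auto)
  qed
qed

section \<open>Measurability with respect to the past models\<close>

lemma past_models_measurable:
  assumes "i < k"
  shows "(\<lambda>\<omega>. M i \<omega> y) \<in> borel_measurable (past_models P M k)"
  proof (rule measurableI)
    fix B :: "real set" assume "B \<in> sets borel"
    then show "(\<lambda>\<omega>. M i \<omega> y) -` B \<inter> space (past_models P M k) \<in> sets (past_models P M k)"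
      unfolding past_models_def using assms
      by (subst space_measure_of; (subst sets_measure_of)?) (auto intro!: sigma_sets.Basic)
  qed simp

lemma subalgebra_past_models:
  assumes "\<And>i y. i < k \<Longrightarrow> (\<lambda>\<omega>. M i \<omega> y) \<in> borel_measurable P"
  shows "subalgebra P (past_models P M k)"
proof -
  have "sigma_sets (space P) {(\<lambda>\<omega>. M j \<omega> y) -` B \<inter> space P | j y B. j < k \<and> B \<in> sets borel}
    \<subseteq> sets P"
    using assms by (intro sets.sigma_sets_subset) (auto intro: measurable_sets)
  moreover have "{(\<lambda>\<omega>. M j \<omega> y) -` B \<inter> space P | j y B. j < k \<and> B \<in> sets borel}
    \<subseteq> Pow (space P)" by auto
  ultimately show ?thesis
    by (simp add: subalgebra_def past_models_def space_measure_of sets_measure_of)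
qed

text \<open>The recursion expresses \<open>X k\<close> and \<open>A k\<close> through the directions
  of index below \<open>k\<close>. The measure \<open>F\<close> is left free because both
  \<open>P\<close> and the sigma-algebra of the past models are needed.\<close>

lemma line_search_run_measurable:
  fixes f :: "'a::euclidean_space \<Rightarrow> real" and X G :: "nat \<Rightarrow> 'w \<Rightarrow> 'a"
  assumes f [measurable]: "f \<in> borel_measurable borel"
    and run: "\<And>\<omega>. \<omega> \<in> space F \<Longrightarrow>
        line_search_run f \<gamma> \<theta> \<alpha>max x0 \<alpha>0 (\<lambda>k. X k \<omega>) (\<lambda>k. A k \<omega>) (\<lambda>k. G k \<omega>)"
    and "\<And>i. i < k \<Longrightarrow> G i \<in> borel_measurable F"
  shows "X k \<in> borel_measurable F \<and> A k \<in> borel_measurable F"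
  using assms(3)
proof (induction k)
  case 0
  have "X 0 \<omega> = x0" "A 0 \<omega> = \<alpha>0" if "\<omega> \<in> space F" for \<omega>
    using run[OF that] by (auto simp: line_search_run_def)
  then show ?case by (auto cong: measurable_cong)
next
  case (Suc k)
  then have [measurable]: "X k \<in> borel_measurable F" "A k \<in> borel_measurable F"
    "G k \<in> borel_measurable F" by auto
  define S where "S \<omega> \<longleftrightarrow> sufficient_decrease f \<theta> (X k \<omega>) (A k \<omega>) (G k \<omega>)" for \<omega>
  have [measurable]: "Measurable.pred F S"
    unfolding S_def sufficient_decrease_def by measurable
  have "X (Suc k) \<in> borel_measurable F \<longleftrightarrow>
      (\<lambda>\<omega>. if S \<omega> then X k \<omega> - A k \<omega> *\<^sub>R G k \<omega> else X k \<omega>) \<in> borel_measurable F"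
    using run by (intro measurable_cong) (auto simp: line_search_run_def S_def)
  moreover have "A (Suc k) \<in> borel_measurable F \<longleftrightarrow>
      (\<lambda>\<omega>. if S \<omega> then min \<alpha>max (inverse \<gamma> * A k \<omega>) else \<gamma> * A k \<omega>) \<in> borel_measurable F"
    using run by (intro measurable_cong) (auto simp: line_search_run_def S_def)
  ultimately show ?case by simp
qed

text \<open>The past is generated by model values, not by directions. The difference of the values
  at a basis vector and at 0 cancels the terms in \<open>f\<close> and \<open>X\<close> and leaves a
  coordinate of \<open>G\<close>.\<close>

lemma direction_measurable_of_linear_model:
  fixes X G :: "'w \<Rightarrow> 'a::euclidean_space"
  assumes "\<And>y. (\<lambda>\<omega>. linear_model f (X \<omega>) (G \<omega>) y) \<in> borel_measurable F"
  shows "G \<in> borel_measurable F"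
proof -
  have "G \<omega> \<bullet> b = linear_model f (X \<omega>) (G \<omega>) b - linear_model f (X \<omega>) (G \<omega>) 0" for \<omega> b
    by (simp add: linear_model_def inner_diff_left inner_commute[of _ b])
  then show ?thesis
    using assms by (subst borel_measurable_euclidean_space) simp
qed

section \<open>Conditional accuracy and tail events of the hitting time\<close>

text \<open>Integrate the bound on the conditional expectation over \<open>B\<close>; as
  \<open>B\<close> lies in \<open>F\<close>, the conditional expectation may be replaced by the
  indicator of \<open>T\<close> there.\<close>

lemma (in finite_measure_subalgebra) measure_Int_ge_of_real_cond_exp_ge:
  assumes T [measurable]: "T \<in> sets M" and B: "B \<in> sets F"
    and p: "AE x in M. p \<le> real_cond_exp M F (indicator T) x"
  shows "p * measure M B \<le> measure M (B \<inter> T)"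
proof -
  have [measurable]: "B \<in> sets M" using B subalg by (auto simp: subalgebra_def)
  have T_integrable: "integrable M (indicator T :: _ \<Rightarrow> real)"
    by (simp add: less_top[symmetric])
  have "p * measure M B = (\<integral>x. indicator B x * p \<partial>M)" by simp
  also have "\<dots> \<le> (\<integral>x. indicator B x * real_cond_exp M F (indicator T) x \<partial>M)"
  proof (rule integral_mono_AE)
    show "integrable M (\<lambda>x. indicator B x * real_cond_exp M F (indicator T) x)"
      using integrable_mult_indicator[OF \<open>B \<in> sets M\<close> real_cond_exp_int(1)[OF T_integrable]]
      by simp
    show "AE x in M. indicator B x * p \<le> indicator B x * real_cond_exp M F (indicator T) x"
      using p by eventually_elim (auto split: split_indicator)
  qed (simp add: less_top[symmetric])
  also have "\<dots> = (\<integral>x. indicator B x * indicator T x \<partial>M)"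
    using real_cond_exp_intA[OF T_integrable B] by (simp add: set_lebesgue_integral_def)
  also have "\<dots> = measure M (B \<inter> T)"
    by (simp add: indicator_inter_arith[symmetric])
  finally show ?thesis .
qed

text \<open>Strictly exceeding \<open>t\<close> means that \<open>Suc t\<close> is a lower bound of
  all stationary indices; with no such index the infimum is infinite, which fits.\<close>

lemma enat_less_hitting_time_iff:
  "enat t < hitting_time gradf \<epsilon> x \<longleftrightarrow> (\<forall>i\<le>t. \<epsilon> < norm (gradf (x i)))"
  unfolding hitting_time_def Suc_ile_eq[symmetric] le_INF_iff
  by (auto simp: not_le[symmetric] not_less_eq_eq)

lemma measurable_enat_of_less:
  fixes N :: "'w \<Rightarrow> enat"
  assumes [measurable]: "\<And>t. {\<omega> \<in> space P. enat t < N \<omega>} \<in> sets P"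
  shows "N \<in> measurable P (count_space UNIV)"
proof (subst measurable_count_space_eq2_countable, intro conjI ballI)
  fix a :: enat
  show "N -` {a} \<inter> space P \<in> sets P"
  proof (cases a)
    case (enat n)
    have "N -` {a} \<inter> space P = {\<omega> \<in> space P. \<not> enat n < N \<omega> \<and> (\<forall>t\<in>{..<n}. enat t < N \<omega>)}"
    proof -
      have "N \<omega> = enat n \<longleftrightarrow> \<not> enat n < N \<omega> \<and> (\<forall>t\<in>{..<n}. enat t < N \<omega>)" for \<omega>
        by (cases "N \<omega>") (auto simp: not_less_iff_gr_or_eq)
      then show ?thesis using enat by auto
    qed
    then show ?thesis by simp
  next
    case infinity
    have "N \<omega> = \<infinity> \<longleftrightarrow> (\<forall>t. enat t < N \<omega>)" for \<omega>
      by (cases "N \<omega>") auto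
    then have "N -` {a} \<inter> space P = {\<omega> \<in> space P. \<forall>t. enat t < N \<omega>}"
      using infinity by auto
    then show ?thesis by simp
  qed
qed auto

section \<open>Expectation of the hitting time\<close>

theorem theorem3p1:
  fixes P :: "'w measure"
    and f :: "real ^ 'n \<Rightarrow> real" and gradf :: "real ^ 'n \<Rightarrow> real ^ 'n"
    and X G :: "nat \<Rightarrow> 'w \<Rightarrow> real ^ 'n" and A :: "nat \<Rightarrow> 'w \<Rightarrow> real"
    and x0 :: "real ^ 'n"
    and \<gamma> \<theta> \<alpha>max \<alpha>0 L \<kappa> p \<epsilon> fstar :: real
    and c j :: nat
  assumes "prob_space P"
    and "0 < \<gamma>" "\<gamma> < 1" and "0 < \<theta>" "\<theta> < 1" and "0 < \<alpha>max" and "0 < \<alpha>0" "\<alpha>0 < \<alpha>max"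
    and gradient: "\<And>x. GDERIV f x :> gradf x"
    and C1: "continuous_on UNIV gradf"
    and bounded_below: "\<And>x. fstar \<le> f x"
    and "0 < L"
    and gradient_Lipschitz: "\<And>x y. norm (gradf x - gradf y) \<le> L * norm (x - y)"
    and random_directions: "\<And>k. G k \<in> borel_measurable P"
    and algorithm: "\<And>\<omega>. \<omega> \<in> space P \<Longrightarrow>
        line_search_run f \<gamma> \<theta> \<alpha>max x0 \<alpha>0 (\<lambda>k. X k \<omega>) (\<lambda>k. A k \<omega>) (\<lambda>k. G k \<omega>)"
    and "0 < \<kappa>" and "1/2 < p"
    and accurate: "prob_sufficiently_accurate P gradf p \<kappa>
        (\<lambda>k \<omega>. linear_model f (X k \<omega>) (G k \<omega>)) X A G"
    and threshold: "0 < c" "(1 - \<theta>) / (0.5 * L + \<kappa>) = \<gamma> ^ c * \<alpha>0"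
        "(1 - \<theta>) / (0.5 * L + \<kappa>) < \<gamma> * \<alpha>max"
    and step_grid: "\<alpha>0 = \<gamma> ^ j * \<alpha>max"
    and "0 < \<epsilon>"
  shows "(\<integral>\<^sup>+ \<omega>. ennreal_of_enat (hitting_time gradf \<epsilon> (\<lambda>k. X k \<omega>)) \<partial>P)
     \<le> ennreal (2 * p / (2 * p - 1)\<^sup>2 *
         ((f x0 - fstar) * (1 + \<kappa> * \<alpha>max)\<^sup>2 * (0.5 * L + \<kappa>) / (\<theta> * (1 - \<theta>)) / \<epsilon>\<^sup>2
          + log \<gamma> ((1 - \<theta>) / (\<alpha>0 * (0.5 * L + \<kappa>)))))"
proof -
  interpret prob_space P by fact
  define models where "models = (\<lambda>k \<omega>. linear_model f (X k \<omega>) (G k \<omega>))"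
  define B where "B k = {\<omega> \<in> space P. \<forall>i\<le>k. \<epsilon> < norm (gradf (X i \<omega>))}" for k
  define T where "T k = {\<omega> \<in> space P. norm (G k \<omega> - gradf (X k \<omega>)) \<le> \<kappa> * A k \<omega> * norm (G k \<omega>)}" for k
  define C where "C = (1 - \<theta>) / (0.5 * L + \<kappa>)"
  define h where "h = \<theta> * (\<gamma> ^ (c + j) * \<alpha>max) * \<epsilon>\<^sup>2 / (1 + \<kappa> * \<alpha>max)\<^sup>2"
  \<comment> \<open>The initial potential with \<open>f\<close> measured from \<open>fstar\<close>;
    the exponents \<open>j\<close> and \<open>c + j\<close> differ by \<open>c\<close>.\<close>
  define D where "D = 2 * ((f x0 - fstar) / h) + c"
  have C: "\<gamma> ^ (c + j) * \<alpha>max = C"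
    using threshold step_grid by (simp add: C_def power_add)
  have "0 < C"
    using \<open>0 < L\<close> \<open>0 < \<kappa>\<close> \<open>\<theta> < 1\<close> unfolding C_def by (intro divide_pos_pos) auto
  have "0 < h"
    using \<open>0 < C\<close> \<open>0 < \<theta>\<close> \<open>0 < \<alpha>max\<close> \<open>0 < \<kappa>\<close> \<open>0 < \<epsilon>\<close> unfolding h_def C
    by (intro divide_pos_pos mult_pos_pos zero_less_power add_pos_pos) auto
  have "0 \<le> (f x0 - fstar) / h"
    using bounded_below[of x0] \<open>0 < h\<close> by simp
  then have "0 \<le> D" unfolding D_def by (intro add_nonneg_nonneg mult_nonneg_nonneg) auto

  have "continuous_on UNIV f"
  proof (intro continuous_at_imp_continuous_on ballI)
    show "isCont f x" for x
      using gradient[of x, unfolded gderiv_def] by (rule has_derivative_continuous)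
  qed
  then have f [measurable]: "f \<in> borel_measurable borel"
    by (rule borel_measurable_continuous_onI)
  have gradf [measurable]: "gradf \<in> borel_measurable borel"
    using C1 by (rule borel_measurable_continuous_onI)
  have [measurable]: "G k \<in> borel_measurable P" for k by (rule random_directions)
  have [measurable]: "X k \<in> borel_measurable P" "A k \<in> borel_measurable P" for k
    using line_search_run_measurable[where F = P and X = X and A = A and G = G, OF f algorithm]
    by auto
  have models: "(\<lambda>\<omega>. models k \<omega> y) \<in> borel_measurable P" for k y
    unfolding models_def linear_model_def by measurable
  have subalg: "subalgebra P (past_models P models k)" for k
    using models by (rule subalgebra_past_models)
  \<comment> \<open>The event involves only \<open>X 0\<close> to \<open>X k\<close>, hence only
    directions of index below \<open>k\<close>, so conditional accuracy at iteration
    \<open>k\<close> applies on it.\<close>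
  have B_past: "B k \<in> sets (past_models P models k)" for k
  proof -
    let ?F = "past_models P models k"
    have space: "space ?F = space P" using subalg by (simp add: subalgebra_def)
    have "G i \<in> borel_measurable ?F" if "i < k" for i
      using past_models_measurable[OF that, of models]
      by (intro direction_measurable_of_linear_model[of f "X i"]) (simp add: models_def)
    then have [measurable]: "X i \<in> borel_measurable ?F" if "i \<le> k" for i
      using that space
        line_search_run_measurable[where F = ?F and X = X and A = A and G = G, OF f algorithm]
      by auto
    have "{\<omega> \<in> space ?F. \<forall>i\<in>{..k}. \<epsilon> < norm (gradf (X i \<omega>))} \<in> sets ?F"
      by measurable
    also have "{\<omega> \<in> space ?F. \<forall>i\<in>{..k}. \<epsilon> < norm (gradf (X i \<omega>))} = B k"
      unfolding B_def space by auto
    finally show ?thesis .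
  qed
  have [measurable]: "B k \<in> sets P" for k
    using B_past subalg by (auto simp: subalgebra_def)
  have [measurable]: "T k \<in> sets P" for k
    unfolding T_def by measurable
  have T_ge: "p * prob (B k) \<le> prob (B k \<inter> T k)" for k
  proof -
    interpret finite_measure_subalgebra P "past_models P models k"
      using subalg by unfold_locales
    show ?thesis
      using accurate B_past by (intro measure_Int_ge_of_real_cond_exp_ge)
        (auto simp: prob_sufficiently_accurate_def T_def models_def)
  qed
  \<comment> \<open>Conditional accuracy on the sure event gives \<open>p \<le> prob (T 0)\<close>.
    The final comparison uses this as \<open>1 \<le> p / (2 * p - 1)\<close>.\<close>
  have "p \<le> 1"
  proof -
    interpret finite_measure_subalgebra P "past_models P models 0"
      using subalg by unfold_locales
    have "space P \<in> sets (past_models P models 0)"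
      using subalg sets.top[of "past_models P models 0"] by (simp add: subalgebra_def)
    then have "p * prob (space P) \<le> prob (space P \<inter> T 0)"
      using accurate by (intro measure_Int_ge_of_real_cond_exp_ge)
        (auto simp: prob_sufficiently_accurate_def T_def models_def)
    then show ?thesis
      using order_trans[OF _ prob_le_1] by (simp add: prob_space)
  qed

  \<comment> \<open>Outside \<open>B n\<close> the new summand vanishes; inside, all earlier
    \<open>B k\<close> hold too and the potential bound applies with
    \<open>K = Suc n\<close>.\<close>
  have pointwise: "(\<Sum>k<n. indicator (B k) \<omega> * (2 * indicator (T k) \<omega> - 1)) \<le> D"
    if \<omega>: "\<omega> \<in> space P" for n \<omega>
  proof (induction n)
    case 0
    then show ?case using \<open>0 \<le> D\<close> by simp
  next
    case (Suc n)
    show ?case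
    proof (cases "\<omega> \<in> B n")
      case False
      then show ?thesis using Suc by simp
    next
      case True
      then have far: "\<epsilon> < norm (gradf (X k \<omega>))" if "k < Suc n" for k
        using that by (auto simp: B_def)
      have "(\<Sum>k<Suc n. indicator (B k) \<omega> * (2 * indicator (T k) \<omega> - 1))
          = (\<Sum>k<Suc n. if \<omega> \<in> T k then 1 else -1 :: real)"
        using far \<omega> by (intro sum.cong) (auto simp: B_def split: split_indicator)
      moreover have "\<exists>n'. A (Suc n) \<omega> = \<gamma> ^ n' * \<alpha>max \<and>
          (\<Sum>k<Suc n. if \<omega> \<in> T k then 1 else -1) + 2 * f (X (Suc n) \<omega>) / h
            + \<bar>real n' - real (c + j)\<bar> \<le> 2 * f x0 / h + \<bar>real j - real (c + j)\<bar>"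
      proof (rule line_search_potential[where g = "\<lambda>k. G k \<omega>" and x = "\<lambda>k. X k \<omega>"
            and \<alpha> = "\<lambda>k. A k \<omega>"])
        show "\<gamma> ^ (c + j) * \<alpha>max * (L / 2 + \<kappa>) = 1 - \<theta>"
          unfolding C C_def using \<open>0 < L\<close> \<open>0 < \<kappa>\<close> by (simp add: field_simps)
        show "h = \<theta> * (\<gamma> ^ (c + j) * \<alpha>max) * \<epsilon>\<^sup>2 / (1 + \<kappa> * \<alpha>max)\<^sup>2" by (rule h_def)
      qed (use assms \<omega> far in \<open>auto simp: T_def\<close>)
      moreover have "2 * fstar / h \<le> 2 * f (X (Suc n) \<omega>) / h"
        using bounded_below \<open>0 < h\<close> by (simp add: divide_right_mono)
      ultimately show ?thesis
        unfolding D_def by (auto simp: diff_divide_distrib)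
    qed
  qed
  define drift :: "nat \<Rightarrow> 'w \<Rightarrow> real"
    where "drift k \<omega> = 2 * indicator (B k \<inter> T k) \<omega> - indicator (B k) \<omega>" for k \<omega>
  have drift_eq: "indicator (B k) \<omega> * (2 * indicator (T k) \<omega> - 1) = drift k \<omega>" for k \<omega>
    by (simp add: drift_def split: split_indicator)
  have drift_integrable: "integrable P (drift k)" for k
    unfolding drift_def by (simp add: less_top[symmetric])
  have partial_sums: "(\<Sum>k<n. prob (B k)) \<le> D / (2 * p - 1)" for n
  proof -
    \<comment> \<open>The expected drift is squeezed between \<open>2 * p - 1\<close> times the tail
      probabilities, by \<open>T_ge\<close>, and the pointwise bound \<open>D\<close>.\<close>
    have "(2 * p - 1) * (\<Sum>k<n. prob (B k)) \<le> (\<Sum>k<n. 2 * prob (B k \<inter> T k) - prob (B k))"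
      unfolding sum_distrib_left using T_ge by (intro sum_mono) (simp add: algebra_simps)
    also have "\<dots> = (\<integral>\<omega>. (\<Sum>k<n. drift k \<omega>) \<partial>P)"
      by (simp add: drift_def less_top[symmetric])
    also have "\<dots> \<le> D"
      using pointwise
      by (intro integral_le_const) (auto simp: drift_eq drift_integrable)
    finally show ?thesis
      using \<open>1/2 < p\<close> by (simp add: field_simps)
  qed

  have hitting: "{\<omega> \<in> space P. enat t < hitting_time gradf \<epsilon> (\<lambda>k. X k \<omega>)} = B t" for t
    by (simp add: enat_less_hitting_time_iff B_def)
  \<comment> \<open>Tail-sum formula: \<open>B t\<close> is the event that the hitting time exceeds
    \<open>t\<close>.\<close>
  have "(\<integral>\<^sup>+ \<omega>. ennreal_of_enat (hitting_time gradf \<epsilon> (\<lambda>k. X k \<omega>)) \<partial>P) = (\<Sum>t. emeasure P (B t))"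
    by (subst nn_integral_enat_function) (auto intro!: measurable_enat_of_less simp: hitting)
  also have "\<dots> \<le> ennreal (D / (2 * p - 1))"
    using partial_sums
    by (intro suminf_le_const summableI) (simp add: emeasure_eq_measure sum_ennreal ennreal_leI)
  \<comment> \<open>Two relaxations yield the stated form: \<open>c\<close> is doubled, and a factor
    \<open>p / (2 * p - 1)\<close>, which is at least 1, is inserted.\<close>
  also have "\<dots> \<le> ennreal (2 * p / (2 * p - 1)\<^sup>2 * ((f x0 - fstar) / h + c))"
  proof (rule ennreal_leI)
    have "D \<le> 2 * ((f x0 - fstar) / h + c)"
      by (simp add: D_def)
    also have "\<dots> \<le> 2 * (p / (2 * p - 1) * ((f x0 - fstar) / h + c))"
      using mult_right_mono[of 1 "p / (2 * p - 1)" "(f x0 - fstar) / h + c"]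
        \<open>1/2 < p\<close> \<open>p \<le> 1\<close> \<open>0 \<le> (f x0 - fstar) / h\<close>
      by (intro mult_left_mono) simp_all
    finally have "D / (2 * p - 1) \<le> 2 * (p / (2 * p - 1) * ((f x0 - fstar) / h + c)) / (2 * p - 1)"
      using \<open>1/2 < p\<close> by (intro divide_right_mono) auto
    then show "D / (2 * p - 1) \<le> 2 * p / (2 * p - 1)\<^sup>2 * ((f x0 - fstar) / h + c)"
      by (simp add: power2_eq_square)
  qed
  also have "(f x0 - fstar) / h = (f x0 - fstar) * (1 + \<kappa> * \<alpha>max)\<^sup>2 * (0.5 * L + \<kappa>) / (\<theta> * (1 - \<theta>)) / \<epsilon>\<^sup>2"
    unfolding h_def C C_def by (simp add: mult_ac)
  also have "real c = log \<gamma> ((1 - \<theta>) / (\<alpha>0 * (0.5 * L + \<kappa>)))"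
  proof -
    have "(1 - \<theta>) / (\<alpha>0 * (0.5 * L + \<kappa>)) = (1 - \<theta>) / (0.5 * L + \<kappa>) / \<alpha>0"
      by simp
    also have "\<dots> = \<gamma> ^ c"
      unfolding threshold(2) using \<open>0 < \<alpha>0\<close> by simp
    finally show ?thesis
      using \<open>0 < \<gamma>\<close> \<open>\<gamma> < 1\<close> by simp
  qed
  finally show ?thesis .
qed

end
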